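(* There is an absolute constant $C>0$ such that for all $u,b\in\mathbb{N}$ and every set $S\subseteq\mathbb{Z}_2^u$ with $2\le |S|\le 2^b$, \[ \mathbb{E}_{T\in_U \mathcal{L}(u,b)}\big[L(T,S)\big]\le C\log |S| . \] That is, $\mathbb{E}_{T\in_U \mathcal{L}(u,b)}[L(T,S)]=O(\log|S|)$.
   Context: $\mathbb{Z}_2^u$ denotes the $u$-dimensional vector space over the two-element field. $\mathcal{L}(u,b)$ denotes the set of all linear maps $\mathbb{Z}_2^u\to\mathbb{Z}_2^b$ (maps $\vec x\mapsto A\vec x$ with $A$ a binary $b\times u$ matrix). For $T\in\mathcal{L}(u,b)$ and $S\subseteq\mathbb{Z}_2^u$, $L(T,S)=\max_{\vec y\in\mathbb{Z}_2^b}|T^{-1}(\vec y)\cap S|$ is the size of a largest bin when the balls $S$ are placed into the bins $\mathbb{Z}_2^b$ by $T$. The notation $\mathbb{E}_{T\in_U H}$ and $\Pr_{T\in_U H}$ means the expectation/probability over a uniformly random choice of $T$ from the finite set $H$. All logarithms are to base 2. *)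

theory Defs
  imports "HOL-Analysis.Analysis"
begin

text \<open>Vectors of Z_2^u are represented as boolean functions on nat supported in {..<u}
  (True = 1). Addition in Z_2 is exclusive or.\<close>
definition vecs :: "nat \<Rightarrow> (nat \<Rightarrow> bool) set" where
  "vecs u = {x. \<forall>i. u \<le> i \<longrightarrow> \<not> x i}"

definition mats :: "nat \<Rightarrow> nat \<Rightarrow> (nat \<Rightarrow> nat \<Rightarrow> bool) set" where
  "mats u b = {A. \<forall>i j. (b \<le> i \<or> u \<le> j) \<longrightarrow> \<not> A i j}"

definition matvec :: "nat \<Rightarrow> nat \<Rightarrow> (nat \<Rightarrow> nat \<Rightarrow> bool) \<Rightarrow> (nat \<Rightarrow> bool) \<Rightarrow> (nat \<Rightarrow> bool)" where
  "matvec u b A x = (\<lambda>i. i < b \<and> odd (card {j. j < u \<and> A i j \<and> x j}))"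

definition linmaps :: "nat \<Rightarrow> nat \<Rightarrow> ((nat \<Rightarrow> bool) \<Rightarrow> (nat \<Rightarrow> bool)) set" where
  "linmaps u b = (\<lambda>A. restrict (matvec u b A) (vecs u)) ` mats u b"

definition maxload :: "nat \<Rightarrow> ((nat \<Rightarrow> bool) \<Rightarrow> (nat \<Rightarrow> bool)) \<Rightarrow> (nat \<Rightarrow> bool) set \<Rightarrow> nat" where
  "maxload b T S = Max ((\<lambda>y. card {x \<in> S. T x = y}) ` vecs b)"

definition exp_maxload :: "nat \<Rightarrow> nat \<Rightarrow> (nat \<Rightarrow> bool) set \<Rightarrow> real" where
  "exp_maxload u b S = (\<Sum>T\<in>linmaps u b. real (maxload b T S)) / real (card (linmaps u b))"

end

theory Submission
  imports Defs
begin

text \<open>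
  Think of \<open>W x\<close> as the image of \<open>(0, x) \<in> \<int>\<^sub>2\<^sup>b \<times> \<int>\<^sub>2\<^sup>u\<close> under \<open>(y, x) \<mapsto> y + W x\<close>. For uniform \<open>W\<close> this map
  can be generated by quotienting out \<open>u\<close> random vectors one after the other, each quotient removing
  one of the last \<open>u\<close> coordinates and merging the bins in pairs \<open>z, z + v\<close>. With \<open>n = |S|\<close>, \<open>t \<le> 1\<close> and
  \<open>h a = exp (t a) - 1 - t a\<close>, follow the energy \<open>H = \<Sum>z. h (load z)\<close>. Merging loads \<open>a\<close> and \<open>c\<close> adds
  \<open>(exp (t a) - 1) (exp (t c) - 1)\<close> to it, and \<open>\<Sum>z. (exp (t load z) - 1) = H + t n\<close>, so a step from
  \<open>2\<^sup>b\<^sup>+\<^sup>k\<^sup>+\<^sup>1\<close> bins raises \<open>H\<close> on average by at most \<open>(H + t n)\<^sup>2 / 2\<^sup>b\<^sup>+\<^sup>k\<^sup>+\<^sup>2 \<le> (H + t\<^sup>2 n) / 2\<^sup>k\<^sup>+\<^sup>1\<close>, as long as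
  \<open>H \<le> n \<le> 2\<^sup>b\<close>. These factors have a bounded product and initially \<open>H \<le> t\<^sup>2 n\<close>; stopping the process when
  \<open>H\<close> exceeds \<open>n\<close>, Markov's inequality shows that \<open>H > n\<close> at the end has probability \<open>O(t\<^sup>2)\<close>. Otherwise the
  maximal load is \<open>O(log n / t)\<close>. The tail \<open>O(t\<^sup>2)\<close> is summable over \<open>t = 2\<^sup>-\<^sup>j\<close> with weights \<open>2\<^sup>j\<close>; subtracting
  the linear term in \<open>h\<close> is what makes it quadratic rather than linear in \<open>t\<close>.
\<close>

section \<open>Linear algebra over Z_2, with matrices built column by column\<close>

definition xorv :: "(nat \<Rightarrow> bool) \<Rightarrow> (nat \<Rightarrow> bool) \<Rightarrow> nat \<Rightarrow> bool"  (infixl \<open>\<oplus>\<close> 65) where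
  "x \<oplus> y = (\<lambda>i. x i \<noteq> y i)"

lemma xorv_in_vecs: "x \<in> vecs u \<Longrightarrow> y \<in> vecs u \<Longrightarrow> x \<oplus> y \<in> vecs u"
  by (auto simp: vecs_def xorv_def)

lemma xorv_cancel [simp]: "x \<oplus> (x \<oplus> y) = y"
  by (auto simp: xorv_def)

lemma bij_betw_xorv:
  assumes "x \<in> vecs u"
  shows "bij_betw (\<lambda>v. x \<oplus> v) (vecs u) (vecs u)"
  by (rule bij_betwI[where g = "\<lambda>v. x \<oplus> v"]) (use assms in \<open>auto intro: xorv_in_vecs\<close>)

lemma bij_betw_vecs_Suc:
  "bij_betw (\<lambda>(c, x). x(k := c)) (UNIV \<times> vecs k) (vecs (Suc k))"
  by (rule bij_betwI[where g = "\<lambda>x. (x k, x(k := False))"])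
    (auto simp: vecs_def le_Suc_eq fun_eq_iff)

lemma vecs_0: "vecs 0 = {\<lambda>_. False}"
  by (auto simp: vecs_def)

lemma finite_vecs [simp]: "finite (vecs u)"
proof (induction u)
  case (Suc u)
  then show ?case
    using bij_betw_finite[OF bij_betw_vecs_Suc[of u]] by simp
qed (simp add: vecs_0)

lemma card_vecs: "card (vecs u) = 2 ^ u"
proof (induction u)
  case (Suc u)
  then show ?case
    using bij_betw_same_card[OF bij_betw_vecs_Suc[of u]]
    by (simp add: card_cartesian_product)
qed (simp add: vecs_0)

lemma odd_card_less_Suc:
  "odd (card {j. j < Suc k \<and> P j}) \<longleftrightarrow> (odd (card {j. j < k \<and> P j}) \<noteq> P k)"
proof -
  have "{j. j < Suc k \<and> P j} = (if P k then insert k {j. j < k \<and> P j} else {j. j < k \<and> P j})"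
    by (auto simp: less_Suc_eq)
  then show ?thesis
    by simp
qed

lemma odd_card_xor:
  "odd (card {j. j < k \<and> P j \<and> (x j \<noteq> y j)}) \<longleftrightarrow>
    (odd (card {j. j < k \<and> P j \<and> x j}) \<noteq> odd (card {j. j < k \<and> P j \<and> y j}))"
  for x y :: "nat \<Rightarrow> bool"
proof (induction k)
  case (Suc k)
  show ?case
    unfolding odd_card_less_Suc Suc.IH by blast
qed simp

lemma matvec_xorv: "matvec k b A (x \<oplus> y) = matvec k b A x \<oplus> matvec k b A y"
  unfolding matvec_def xorv_def odd_card_xor by auto

lemma matvec_in_vecs: "matvec k b A x \<in> vecs b"
  by (auto simp: matvec_def vecs_def)

definition addcol :: "nat \<Rightarrow> (nat \<Rightarrow> bool) \<Rightarrow> (nat \<Rightarrow> nat \<Rightarrow> bool) \<Rightarrow> nat \<Rightarrow> nat \<Rightarrow> bool" where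
  "addcol k w A = (\<lambda>i j. if j = k then w i else A i j)"

lemma matvec_addcol:
  assumes "w \<in> vecs b"
  shows "matvec (Suc k) b (addcol k w A) x = matvec k b A x \<oplus> (\<lambda>i. x k \<and> w i)"
proof
  fix i
  have *: "{j. j < k \<and> addcol k w A i j \<and> x j} = {j. j < k \<and> A i j \<and> x j}"
    by (auto simp: addcol_def)
  have "odd (card {j. j < Suc k \<and> addcol k w A i j \<and> x j}) \<longleftrightarrow>
      (odd (card {j. j < k \<and> A i j \<and> x j}) \<noteq> (w i \<and> x k))"
    unfolding odd_card_less_Suc * by (simp add: addcol_def)
  then show "matvec (Suc k) b (addcol k w A) x i = (matvec k b A x \<oplus> (\<lambda>i. x k \<and> w i)) i"
    using assms by (auto simp: matvec_def xorv_def vecs_def not_less[symmetric])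
qed

lemma matvec_upd_ge: "matvec k b A (x(k := c)) = matvec k b A x"
proof -
  have "{j. j < k \<and> A i j \<and> (x(k := c)) j} = {j. j < k \<and> A i j \<and> x j}" for i
    by auto
  then show ?thesis
    by (simp add: matvec_def)
qed

lemma bij_betw_addcol:
  "bij_betw (\<lambda>(A, w). addcol k w A) (mats k b \<times> vecs b) (mats (Suc k) b)"
  by (rule bij_betwI[where g = "\<lambda>A. (\<lambda>i j. j \<noteq> k \<and> A i j, \<lambda>i. A i k)"])
    (auto simp: vecs_def mats_def addcol_def le_Suc_eq fun_eq_iff)

lemma mats_0: "mats 0 b = {\<lambda>_ _. False}"
  by (auto simp: mats_def)

lemma finite_mats [simp]: "finite (mats k b)"
proof (induction k)
  case (Suc k)
  then show ?case
    using bij_betw_finite[OF bij_betw_addcol[of k b]] by simp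
qed (simp add: mats_0)

lemma card_mats_Suc: "card (mats (Suc k) b) = 2 ^ b * card (mats k b)"
  using bij_betw_same_card[OF bij_betw_addcol[of k b]]
  by (simp add: card_cartesian_product card_vecs mult.commute)

text \<open>The expectation ranges over maps, the argument below over matrices. Unit vectors recover
  the entries, so both uniform distributions agree.\<close>

lemma inj_on_matvec: "inj_on (\<lambda>A. restrict (matvec u b A) (vecs u)) (mats u b)"
proof (rule inj_onI)
  fix A B
  assume A: "A \<in> mats u b" and B: "B \<in> mats u b"
    and eq: "restrict (matvec u b A) (vecs u) = restrict (matvec u b B) (vecs u)"
  have unit: "matvec u b M (\<lambda>l. l = j) i = M i j" if "M \<in> mats u b" "i < b" "j < u" for M i j
  proof -
    have "{l. l < u \<and> M i l \<and> l = j} = (if M i j then {j} else {})"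
      using that by auto
    then show ?thesis
      using that by (simp add: matvec_def)
  qed
  show "A = B"
  proof (intro ext)
    fix i j
    show "A i j = B i j"
    proof (cases "i < b \<and> j < u")
      case True
      then have "(\<lambda>l. l = j) \<in> vecs u"
        by (auto simp: vecs_def)
      then have "matvec u b A (\<lambda>l. l = j) = matvec u b B (\<lambda>l. l = j)"
        using fun_cong[OF eq, of "\<lambda>l. l = j"] by simp
      then show ?thesis
        using unit A B True by metis
    next
      case False
      then show ?thesis
        using A B by (auto simp: mats_def not_less)
    qed
  qed
qed

section \<open>Exponential energy of a load distribution\<close>

definition excess :: "real \<Rightarrow> nat \<Rightarrow> real" where
  "excess t a = exp (t * real a) - 1 - t * real a"

lemma excess_nonneg: "0 \<le> excess t a"
  using exp_ge_add_one_self[of "t * real a"] unfolding excess_def by linarith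

lemma excess_0 [simp]: "excess t 0 = 0"
  by (simp add: excess_def)

lemma excess_add:
  "excess t (a + c) = excess t a + excess t c + (exp (t * a) - 1) * (exp (t * c) - 1)"
  by (simp add: excess_def algebra_simps exp_add)

text \<open>The type of bins stays open: they are pairs while coordinates remain, and elements of
  \<open>vecs b\<close> at the end.\<close>

definition energy :: "real \<Rightarrow> 's set \<Rightarrow> 'a set \<Rightarrow> ('s \<Rightarrow> 'a) \<Rightarrow> real" where
  "energy t S Z \<tau> = (\<Sum>z\<in>Z. excess t (card {s\<in>S. \<tau> s = z}))"

lemma energy_nonneg: "0 \<le> energy t S Z \<tau>"
  by (simp add: energy_def sum_nonneg excess_nonneg)

lemma sum_card_fibres:
  assumes "finite S" "finite Z" "\<tau> ` S \<subseteq> Z"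
  shows "(\<Sum>z\<in>Z. real (card {s\<in>S. \<tau> s = z})) = real (card S)"
proof -
  have "(\<Sum>z\<in>Z. card {s\<in>S. \<tau> s = z}) = card S"
    using sum.group[OF assms, of "\<lambda>_. 1::nat"] by simp
  then show ?thesis
    by (simp flip: of_nat_sum)
qed

lemma sum_exp_load:
  assumes "finite S" "finite Z" "\<tau> ` S \<subseteq> Z"
  shows "(\<Sum>z\<in>Z. exp (t * real (card {s\<in>S. \<tau> s = z})) - 1) = energy t S Z \<tau> + t * real (card S)"
  unfolding sum_card_fibres[OF assms, symmetric] energy_def excess_def
  by (simp add: sum_distrib_left sum.distrib[symmetric])

text \<open>For fixed \<open>z\<close> the point \<open>f z v\<close> visits every bin exactly once,
  so after swapping the sums the product term decouples.\<close>

lemma sum_translates: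
  fixes B D :: "'a \<Rightarrow> real"
  assumes "finite Z" "\<And>z. z \<in> Z \<Longrightarrow> bij_betw (f z) Z Z"
  shows "(\<Sum>v\<in>Z. \<Sum>z\<in>Z. A z + B (f z v) + C z * D (f z v)) =
    real (card Z) * (sum A Z + sum B Z) + sum C Z * sum D Z"
proof -
  have "(\<Sum>v\<in>Z. \<Sum>z\<in>Z. A z + B (f z v) + C z * D (f z v)) =
      (\<Sum>z\<in>Z. \<Sum>v\<in>Z. A z + B (f z v) + C z * D (f z v))"
    by (rule sum.swap)
  also have "\<dots> = (\<Sum>z\<in>Z. real (card Z) * A z + sum B Z + C z * sum D Z)"
  proof (rule sum.cong[OF refl])
    fix z assume "z \<in> Z"
    then show "(\<Sum>v\<in>Z. A z + B (f z v) + C z * D (f z v)) = real (card Z) * A z + sum B Z + C z * sum D Z"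
      using sum.reindex_bij_betw[OF assms(2), of z B] sum.reindex_bij_betw[OF assms(2), of z D]
      by (simp add: sum.distrib sum_distrib_left[symmetric])
  qed
  finally show ?thesis
    by (simp add: sum.distrib distrib_left sum_distrib_left[symmetric] sum_distrib_right[symmetric])
qed

section \<open>Merging bins along a random vector\<close>

text \<open>The quotient of \<open>\<int>\<^sub>2\<^sup>b \<times> \<int>\<^sub>2\<^sup>k\<^sup>+\<^sup>1\<close> by the vector \<open>v + e\<^sub>k\<close>, with representatives in
  \<open>\<int>\<^sub>2\<^sup>b \<times> \<int>\<^sub>2\<^sup>k\<close>.\<close>
definition fuse :: "nat \<Rightarrow> (nat \<Rightarrow> bool) \<times> (nat \<Rightarrow> bool) \<Rightarrow>
    (nat \<Rightarrow> bool) \<times> (nat \<Rightarrow> bool) \<Rightarrow> (nat \<Rightarrow> bool) \<times> (nat \<Rightarrow> bool)" where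
  "fuse k v z = (if snd z k then (fst z \<oplus> fst v, (snd z)(k := False) \<oplus> snd v) else z)"

lemma fuse_in:
  assumes "v \<in> vecs b \<times> vecs k" "z \<in> vecs b \<times> vecs (Suc k)"
  shows "fuse k v z \<in> vecs b \<times> vecs k"
proof -
  have "(snd z)(k := False) \<in> vecs k" "\<not> snd z k \<Longrightarrow> snd z \<in> vecs k"
    using assms by (auto simp: vecs_def) (metis Suc_leI le_neq_implies_less)+
  then show ?thesis
    using assms by (auto simp: fuse_def intro: xorv_in_vecs)
qed

text \<open>A map \<open>(y, x) |-> y + W x\<close> factors through the quotient iff it kills
  \<open>v + e_k\<close>. This forces column \<open>k\<close> of \<open>W\<close> to be
  \<open>A (snd v) + fst v\<close>.\<close>

lemma fuse_matvec:
  assumes "v \<in> vecs b \<times> vecs k"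
  shows "fst (fuse k v z) \<oplus> matvec k b A (snd (fuse k v z)) =
    fst z \<oplus> matvec (Suc k) b (addcol k (matvec k b A (snd v) \<oplus> fst v) A) (snd z)"
proof -
  have "matvec k b A (snd v) \<oplus> fst v \<in> vecs b"
    using assms by (auto intro: xorv_in_vecs matvec_in_vecs)
  then show ?thesis
    by (simp add: fuse_def matvec_addcol matvec_xorv matvec_upd_ge)
      (auto simp: xorv_def fun_eq_iff)
qed

lemma sum_vecs_Suc:
  fixes \<phi> :: "(nat \<Rightarrow> bool) \<times> (nat \<Rightarrow> bool) \<Rightarrow> real"
  shows "(\<Sum>z\<in>vecs b \<times> vecs (Suc k). \<phi> z) =
    (\<Sum>z\<in>vecs b \<times> vecs k. \<phi> z) + (\<Sum>z\<in>vecs b \<times> vecs k. \<phi> (fst z, (snd z)(k := True)))"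
proof -
  have upd: "x(k := False) = x" if "x \<in> vecs k" for x
    using that by (auto simp: vecs_def fun_eq_iff)
  have "(\<Sum>x\<in>vecs (Suc k). \<phi> (y, x)) =
      (\<Sum>x\<in>vecs k. \<phi> (y, x)) + (\<Sum>x\<in>vecs k. \<phi> (y, x(k := True)))" for y
    unfolding sum.reindex_bij_betw[OF bij_betw_vecs_Suc[of k], symmetric]
    by (simp add: sum.cartesian_product' UNIV_bool upd)
  then show ?thesis
    by (simp add: sum.cartesian_product' sum.distrib)
qed


lemma card_fuse_fibre:
  assumes v: "v \<in> vecs b \<times> vecs k" and z: "z \<in> vecs b \<times> vecs k" and "finite S"
  shows "card {s\<in>S. fuse k v (\<tau> s) = z} = card {s\<in>S. \<tau> s = z} +
    card {s\<in>S. \<tau> s = (fst z \<oplus> fst v, (snd z \<oplus> snd v)(k := True))}"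
proof -
  have 0: "\<not> snd z k" "\<not> snd v k"
    using v z by (auto simp: vecs_def)
  have "fuse k v w = z \<longleftrightarrow> w = z \<or> w = (fst z \<oplus> fst v, (snd z \<oplus> snd v)(k := True))" for w
    using 0 by (cases w; cases z; cases v) (auto simp: fuse_def xorv_def fun_eq_iff)
  then have "{s\<in>S. fuse k v (\<tau> s) = z} = {s\<in>S. \<tau> s = z} \<union>
      {s\<in>S. \<tau> s = (fst z \<oplus> fst v, (snd z \<oplus> snd v)(k := True))}"
    by auto
  moreover have "z \<noteq> (fst z \<oplus> fst v, (snd z \<oplus> snd v)(k := True))"
    using 0 by (metis fun_upd_same snd_conv)
  then have "{s\<in>S. \<tau> s = z} \<inter> {s\<in>S. \<tau> s = (fst z \<oplus> fst v, (snd z \<oplus> snd v)(k := True))} = {}"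
    by auto
  ultimately show ?thesis
    using \<open>finite S\<close> by (simp add: card_Un_disjoint)
qed

lemma sum_energy_fuse_le:
  fixes t :: real and b k :: nat
  defines "Z \<equiv> vecs b \<times> vecs k" and "Z' \<equiv> vecs b \<times> vecs (Suc k)"
  assumes S: "finite S" and \<tau>: "\<tau> ` S \<subseteq> Z'"
  shows "(\<Sum>v\<in>Z. energy t S Z (fuse k v \<circ> \<tau>)) \<le>
    real (card Z) * energy t S Z' \<tau> + (energy t S Z' \<tau> + t * real (card S))\<^sup>2 / 4"
proof -
  define N where "N z = card {s\<in>S. \<tau> s = z}" for z
  \<comment> \<open>\<open>N\<close> on \<open>Z\<close> and \<open>M\<close> are the loads of the
    two halves, with coordinate \<open>k\<close> equal to 0 and 1. Fusing along \<open>v\<close>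
    merges bin \<open>z\<close> of the first half with bin \<open>f z v\<close> of the
    second.\<close>
  define M where "M z = N (fst z, (snd z)(k := True))" for z
  define f where "f z v = (fst z \<oplus> fst v, snd z \<oplus> snd v)" for z v :: "(nat \<Rightarrow> bool) \<times> (nat \<Rightarrow> bool)"
  have bij: "bij_betw (f z) Z Z" if "z \<in> Z" for z
    by (rule bij_betwI[where g = "f z"])
      (use that in \<open>auto simp: Z_def f_def intro: xorv_in_vecs\<close>)
  have fin: "finite Z" "finite Z'"
    by (auto simp: Z_def Z'_def)
  define P where "P = (\<Sum>z\<in>Z. exp (t * N z) - 1)"
  define Q where "Q = (\<Sum>z\<in>Z. exp (t * M z) - 1)"
  have "(\<Sum>v\<in>Z. energy t S Z (fuse k v \<circ> \<tau>)) = (\<Sum>v\<in>Z. \<Sum>z\<in>Z. excess t (N z) + excess t (M (f z v)) +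
      (exp (t * N z) - 1) * (exp (t * M (f z v)) - 1))"
    unfolding energy_def
  proof (intro sum.cong refl)
    fix v z assume "v \<in> Z" "z \<in> Z"
    then have "card {s\<in>S. (fuse k v \<circ> \<tau>) s = z} = N z + M (f z v)"
      using card_fuse_fibre[of v b k z S \<tau>] S by (simp add: Z_def N_def M_def f_def)
    then show "excess t (card {s\<in>S. (fuse k v \<circ> \<tau>) s = z}) = excess t (N z) + excess t (M (f z v)) +
      (exp (t * N z) - 1) * (exp (t * M (f z v)) - 1)"
      by (simp add: excess_add)
  qed
  also have "\<dots> = real (card Z) * ((\<Sum>z\<in>Z. excess t (N z)) + (\<Sum>z\<in>Z. excess t (M z))) + P * Q"
    unfolding P_def Q_def
    by (rule sum_translates[where B = "\<lambda>z. excess t (M z)" and D = "\<lambda>z. exp (t * M z) - 1"])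
      (use fin bij in auto)
  also have "(\<Sum>z\<in>Z. excess t (N z)) + (\<Sum>z\<in>Z. excess t (M z)) = energy t S Z' \<tau>"
    unfolding energy_def Z_def Z'_def M_def N_def by (rule sum_vecs_Suc[symmetric])
  finally have 1: "(\<Sum>v\<in>Z. energy t S Z (fuse k v \<circ> \<tau>)) = real (card Z) * energy t S Z' \<tau> + P * Q" .
  have "P + Q = (\<Sum>z\<in>Z'. exp (t * N z) - 1)"
    unfolding P_def Q_def Z_def Z'_def M_def by (rule sum_vecs_Suc[symmetric])
  also have "\<dots> = energy t S Z' \<tau> + t * real (card S)"
    unfolding N_def by (rule sum_exp_load[OF S fin(2) \<tau>])
  finally have 2: "P + Q = energy t S Z' \<tau> + t * real (card S)" .
  \<comment> \<open>Only the sum \<open>P + Q\<close> is controlled; AM-GM removes the dependence on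
    how it splits over the halves.\<close>
  have "P * Q \<le> (P + Q)\<^sup>2 / 4"
    using sum_squares_ge_zero[of "P - Q" 0] by (simp add: power2_eq_square algebra_simps)
  then show ?thesis
    unfolding 1 2 by simp
qed

text \<open>Adding \<open>t^2 n\<close> to the energy makes the one-step bound multiplicative, hence
  easy to iterate. The assumption \<open>small\<close> linearises the quadratic term:
  \<open>E^2 <= n E\<close>.\<close>

lemma avg_energy_fuse_le:
  fixes t :: real and b k :: nat
  defines "Z \<equiv> vecs b \<times> vecs k" and "Z' \<equiv> vecs b \<times> vecs (Suc k)"
  assumes S: "finite S" and \<tau>: "\<tau> ` S \<subseteq> Z'" and n: "card S \<le> 2 ^ b"
    and small: "energy t S Z' \<tau> \<le> real (card S)"
  shows "(\<Sum>v\<in>Z. energy t S Z (fuse k v \<circ> \<tau>) + t\<^sup>2 * real (card S)) \<le>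
    real (card Z) * ((1 + 1 / 2 ^ Suc k) * (energy t S Z' \<tau> + t\<^sup>2 * real (card S)))"
proof -
  define E where "E = energy t S Z' \<tau>"
  define n where "n = real (card S)"
  have E: "0 \<le> E" "E \<le> n"
    using small energy_nonneg by (auto simp: E_def n_def)
  have cZ: "real (card Z) = 2 ^ b * 2 ^ k"
    by (simp add: Z_def card_cartesian_product card_vecs)
  have n2: "n \<le> 2 ^ b"
    using n unfolding n_def by (metis of_nat_le_iff of_nat_numeral of_nat_power)
  have "(E + t * n)\<^sup>2 \<le> 2 * (E\<^sup>2 + t\<^sup>2 * n\<^sup>2)"
    using sum_squares_ge_zero[of "E - t * n" 0] by (simp add: power2_eq_square algebra_simps)
  moreover have "E\<^sup>2 \<le> n * E"
    using E by (simp add: power2_eq_square mult_right_mono)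
  moreover have "n * (E + t\<^sup>2 * n) \<le> 2 ^ b * (E + t\<^sup>2 * n)"
    using E n2 by (intro mult_right_mono) auto
  ultimately have "(E + t * n)\<^sup>2 / 4 \<le> 2 ^ b * (E + t\<^sup>2 * n) / 2"
    by (simp add: power2_eq_square algebra_simps)
  also have "\<dots> = real (card Z) * (1 / 2 ^ Suc k * (E + t\<^sup>2 * n))"
    by (simp add: cZ)
  finally have "(E + t * n)\<^sup>2 / 4 \<le> real (card Z) * (1 / 2 ^ Suc k * (E + t\<^sup>2 * n))" .
  moreover have "(\<Sum>v\<in>Z. energy t S Z (fuse k v \<circ> \<tau>)) \<le> real (card Z) * E + (E + t * n)\<^sup>2 / 4"
    using sum_energy_fuse_le[OF S, of \<tau> b k t] \<tau> by (simp add: E_def n_def Z_def Z'_def)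
  ultimately show ?thesis
    unfolding E_def[symmetric] n_def[symmetric] distrib_right[of 1] distrib_left[of "real (card Z)"]
    by (simp only: sum.distrib sum_constant distrib_left mult_1)
qed

section \<open>Random hashing as a sequence of fusions\<close>

definition hash :: "nat \<Rightarrow> nat \<Rightarrow> (nat \<Rightarrow> nat \<Rightarrow> bool) \<Rightarrow>
    (nat \<Rightarrow> bool) \<times> (nat \<Rightarrow> bool) \<Rightarrow> nat \<Rightarrow> bool" where
  "hash k b W z = fst z \<oplus> matvec k b W (snd z)"

text \<open>For fixed \<open>A\<close> and \<open>snd v\<close> the new column \<open>A (snd v) + fst v\<close> is uniform, so fusing along a
  random \<open>v\<close> and then hashing with a random \<open>A\<close> amounts to hashing with a random matrix that has one
  more column.\<close>
lemma sum_mats_fuse: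
  fixes \<Phi> :: "('s \<Rightarrow> nat \<Rightarrow> bool) \<Rightarrow> real"
  shows "(\<Sum>v\<in>vecs b \<times> vecs k. \<Sum>A\<in>mats k b. \<Phi> (hash k b A \<circ> (fuse k v \<circ> \<tau>))) =
    2 ^ k * (\<Sum>W\<in>mats (Suc k) b. \<Phi> (hash (Suc k) b W \<circ> \<tau>))"
proof -
  define \<Psi> where "\<Psi> W = \<Phi> (hash (Suc k) b W \<circ> \<tau>)" for W
  have fuse: "hash k b A \<circ> (fuse k v \<circ> \<tau>) =
      hash (Suc k) b (addcol k (matvec k b A (snd v) \<oplus> fst v) A) \<circ> \<tau>"
    if "v \<in> vecs b \<times> vecs k" for v A
    using that by (auto simp: hash_def fuse_matvec)
  have "(\<Sum>v\<in>vecs b \<times> vecs k. \<Sum>A\<in>mats k b. \<Phi> (hash k b A \<circ> (fuse k v \<circ> \<tau>))) =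
      (\<Sum>v\<in>vecs b \<times> vecs k. \<Sum>A\<in>mats k b. \<Psi> (addcol k (matvec k b A (snd v) \<oplus> fst v) A))"
    by (intro sum.cong refl) (simp only: fuse \<Psi>_def)
  also have "\<dots> = (\<Sum>v0\<in>vecs b. \<Sum>v1\<in>vecs k. \<Sum>A\<in>mats k b. \<Psi> (addcol k (matvec k b A v1 \<oplus> v0) A))"
    by (simp add: sum.cartesian_product')
  also have "\<dots> = (\<Sum>v1\<in>vecs k. \<Sum>A\<in>mats k b. \<Sum>v0\<in>vecs b. \<Psi> (addcol k (matvec k b A v1 \<oplus> v0) A))"
    by (subst sum.swap, intro sum.cong refl, rule sum.swap)
  also have "\<dots> = (\<Sum>v1\<in>vecs k. \<Sum>A\<in>mats k b. \<Sum>w\<in>vecs b. \<Psi> (addcol k w A))"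
  proof -
    have "(\<Sum>v0\<in>vecs b. \<Psi> (addcol k (matvec k b A v1 \<oplus> v0) A)) = (\<Sum>w\<in>vecs b. \<Psi> (addcol k w A))" for v1 A
      using sum.reindex_bij_betw[OF bij_betw_xorv[OF matvec_in_vecs[of k b A v1]],
          of "\<lambda>w. \<Psi> (addcol k w A)"] by simp
    then show ?thesis
      by simp
  qed
  \<comment> \<open>The summand no longer involves \<open>v1\<close>, whose \<open>2 ^ k\<close>
    choices give the factor.\<close>
  also have "\<dots> = 2 ^ k * (\<Sum>W\<in>mats (Suc k) b. \<Psi> W)"
    unfolding sum.reindex_bij_betw[OF bij_betw_addcol[of k b], symmetric]
    by (simp add: card_vecs sum.cartesian_product')
  finally show ?thesis
    by (simp add: \<Psi>_def)
qed

text \<open>Markov's inequality with the stopping rule built into the induction: once the energy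
  exceeds \<open>n\<close> the bound is trivial. The exponent \<open>1 - 1 / 2 ^ k\<close> is the
  sum of \<open>1 / 2 ^ j\<close> for \<open>j\<close> from 1 to \<open>k\<close>, so by
  \<open>1 + x <= exp x\<close> the factor dominates the product of all one-step factors.\<close>

lemma prob_energy_hash_gt:
  assumes S: "finite S" and n: "card S \<le> 2 ^ b" and \<tau>: "\<tau> ` S \<subseteq> vecs b \<times> vecs k"
  shows "real (card S) * (\<Sum>W\<in>mats k b. of_bool (real (card S) < energy t S (vecs b) (hash k b W \<circ> \<tau>)))
    \<le> real (card (mats k b)) * (exp (1 - 1 / 2 ^ k) *
        (energy t S (vecs b \<times> vecs k) \<tau> + t\<^sup>2 * real (card S)))"
  using \<tau>
proof (induction k arbitrary: \<tau>)
  case 0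
  let ?W = "\<lambda>(_::nat) (_::nat). False"
  have h: "hash 0 b ?W z = fst z" for z
    by (simp add: hash_def matvec_def xorv_def)
  have "energy t S (vecs b) (hash 0 b ?W \<circ> \<tau>) = energy t S (vecs b \<times> vecs 0) \<tau>"
  proof -
    have "{s \<in> S. fst (\<tau> s) = y} = {s \<in> S. \<tau> s = (y, \<lambda>_. False)}" for y
      using 0 by (force simp: vecs_0)
    then show ?thesis
      by (simp add: energy_def h vecs_0 sum.cartesian_product')
  qed
  \<comment> \<open>Pointwise Markov: \<open>n\<close> times the indicator of \<open>n < H\<close>
    is at most \<open>H\<close>.\<close>
  then show ?case
    using energy_nonneg[of t S "vecs b \<times> vecs 0" \<tau>] by (simp add: mats_0 o_def add_increasing2 del: sum_of_bool_eq)
next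
  case (Suc k)
  let ?Z = "vecs b \<times> vecs k" and ?Z' = "vecs b \<times> vecs (Suc k)"
  let ?n = "real (card S)"
  let ?E = "energy t S ?Z' \<tau>"
  let ?bad = "\<lambda>\<sigma>. of_bool (?n < energy t S (vecs b) \<sigma>) :: real"
  let ?F = "\<Sum>W\<in>mats (Suc k) b. ?bad (hash (Suc k) b W \<circ> \<tau>)"
  show ?case
  proof (cases "?E \<le> ?n")
    case False
    \<comment> \<open>The claimed bound on the probability is at least 1.\<close>
    have "?F \<le> real (card (mats (Suc k) b))"
      using sum_bounded_above[of "mats (Suc k) b" "\<lambda>W. ?bad (hash (Suc k) b W \<circ> \<tau>)" 1] by simp
    moreover have "?n \<le> exp (1 - 1 / 2 ^ Suc k) * (?E + t\<^sup>2 * ?n)"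
    proof -
      have "1 / 2 ^ Suc k \<le> (1 :: real)"
        by (subst divide_le_eq_1_pos) (use one_le_power[of "2::real" "Suc k"] in auto)
      then have "1 \<le> exp (1 - 1 / 2 ^ Suc k :: real)"
        by simp
      moreover have "?n \<le> ?E + t\<^sup>2 * ?n"
        using False by (simp add: add_increasing2)
      ultimately show ?thesis
        using mult_mono[of 1 "exp (1 - 1 / 2 ^ Suc k :: real)" ?n "?E + t\<^sup>2 * ?n"] by simp
    qed
    ultimately show ?thesis
      by (subst mult.commute) (intro mult_mono, auto simp: sum_nonneg)
  next
    case True
    have cexp: "exp (1 - 1 / 2 ^ k) * (1 + 1 / 2 ^ Suc k) \<le> exp (1 - 1 / 2 ^ Suc k :: real)"
    proof -
      have "exp (1 - 1 / 2 ^ k) * (1 + 1 / 2 ^ Suc k) \<le> exp (1 - 1 / 2 ^ k) * exp (1 / 2 ^ Suc k :: real)"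
        by (intro mult_left_mono exp_ge_add_one_self) auto
      also have "\<dots> = exp (1 - 1 / 2 ^ Suc k)"
        by (simp add: exp_add[symmetric])
      finally show ?thesis .
    qed
    \<comment> \<open>Condition on the first fusion; the induction hypothesis then applies to each
      fused placement.\<close>
    have "2 ^ k * (?n * ?F) = (\<Sum>v\<in>?Z. ?n * (\<Sum>A\<in>mats k b. ?bad (hash k b A \<circ> (fuse k v \<circ> \<tau>))))"
      unfolding sum_distrib_left[symmetric] sum_mats_fuse[where \<Phi> = ?bad] by (simp only: mult_ac)
    also have "\<dots> \<le> (\<Sum>v\<in>?Z. real (card (mats k b)) *
        (exp (1 - 1 / 2 ^ k) * (energy t S ?Z (fuse k v \<circ> \<tau>) + t\<^sup>2 * ?n)))"
      by (intro sum_mono Suc.IH) (use Suc.prems fuse_in[of _ b k] in fastforce)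
    also have "\<dots> = real (card (mats k b)) *
        (exp (1 - 1 / 2 ^ k) * (\<Sum>v\<in>?Z. energy t S ?Z (fuse k v \<circ> \<tau>) + t\<^sup>2 * ?n))"
      by (simp only: sum_distrib_left)
    also have "\<dots> \<le> real (card (mats k b)) *
        (exp (1 - 1 / 2 ^ k) * (real (card ?Z) * ((1 + 1 / 2 ^ Suc k) * (?E + t\<^sup>2 * ?n))))"
      by (intro mult_left_mono avg_energy_fuse_le S Suc.prems n True) auto
    also have "\<dots> = 2 ^ k * (real (card (mats (Suc k) b)) *
        ((exp (1 - 1 / 2 ^ k) * (1 + 1 / 2 ^ Suc k)) * (?E + t\<^sup>2 * ?n)))"
      by (simp add: card_mats_Suc card_cartesian_product card_vecs mult_ac)
    also have "\<dots> \<le> 2 ^ k * (real (card (mats (Suc k) b)) *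
        (exp (1 - 1 / 2 ^ Suc k) * (?E + t\<^sup>2 * ?n)))"
      by (intro mult_left_mono mult_right_mono cexp) (auto simp: energy_nonneg)
    finally show ?thesis
      by (simp only: mult_le_cancel_left_pos zero_less_power zero_less_numeral)
  qed
qed


section \<open>Tail bound for the maximal load\<close>

lemma excess_one_le: "excess t 1 \<le> t\<^sup>2" if "0 \<le> t" "t \<le> 1"
  using exp_bound[OF that] by (simp add: excess_def)

lemma energy_inj_on:
  assumes "inj_on \<tau> S" "finite S" "finite Z" "0 \<le> t" "t \<le> 1" "\<tau> ` S \<subseteq> Z"
  shows "energy t S Z \<tau> \<le> t\<^sup>2 * real (card S)"
proof -
  have fibre: "excess t (card {s\<in>S. \<tau> s = z}) \<le> t\<^sup>2 * real (card {s\<in>S. \<tau> s = z})" for z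
  proof -
    have "card {s\<in>S. \<tau> s = z} \<le> 1"
      using assms by (subst card_le_Suc0_iff_eq[unfolded One_nat_def[symmetric]]) (auto simp: inj_on_def)
    then consider "card {s\<in>S. \<tau> s = z} = 0" | "card {s\<in>S. \<tau> s = z} = 1"
      by linarith
    then show ?thesis
    proof cases
      case 1
      then show ?thesis
        unfolding 1 by simp
    next
      case 2
      then show ?thesis
        unfolding 2 using excess_one_le[OF assms(4,5)] by simp
    qed
  qed
  then have "energy t S Z \<tau> \<le> (\<Sum>z\<in>Z. t\<^sup>2 * real (card {s\<in>S. \<tau> s = z}))"
    unfolding energy_def by (intro sum_mono)
  also have "\<dots> = t\<^sup>2 * real (card S)"
    using sum_card_fibres[of S Z \<tau>] assms by (simp add: sum_distrib_left[symmetric])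
  finally show ?thesis .
qed

text \<open>With \<open>w = exp (t a / 2)\<close>, the bound \<open>t a <= 2 (w - 1)\<close> absorbs
  the linear term: the excess is at least \<open>(w - 1)^2\<close>. Hence \<open>w <= n^2\<close>;
  the halved exponent and this square give the 4.\<close>

lemma excess_le_imp_load_le:
  assumes "0 \<le> t" "2 \<le> n" "excess t a \<le> real n"
  shows "t * real a \<le> 4 * ln (real n)"
proof -
  define w where "w = exp (t * real a / 2)"
  have "exp (t * real a) = w\<^sup>2"
    by (simp add: w_def power2_eq_square exp_add[symmetric])
  moreover have "1 + t * real a / 2 \<le> w"
    unfolding w_def by (rule exp_ge_add_one_self)
  moreover have n2: "real n + 1 \<le> (real n)\<^sup>2"
  proof -
    have "2 * real n \<le> real n * real n"
      using assms by (intro mult_right_mono) auto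
    moreover have "2 \<le> real n"
      using assms by simp
    ultimately show ?thesis
      unfolding power2_eq_square by linarith
  qed
  ultimately have "(w - 1)\<^sup>2 \<le> real n + 1"
    using assms by (simp add: excess_def power2_eq_square algebra_simps)
  also have "\<dots> \<le> (real n)\<^sup>2"
    by (rule n2)
  finally have "w - 1 \<le> real n"
    by (rule power2_le_imp_le) simp
  also have "real n \<le> (real n)\<^sup>2 - 1"
    using n2 by simp
  finally have "w \<le> (real n)\<^sup>2"
    by simp
  then have "ln w \<le> ln ((real n)\<^sup>2)"
    by (subst ln_le_cancel_iff) (use assms in \<open>auto simp: w_def\<close>)
  then show ?thesis
    using assms by (simp add: w_def ln_realpow)
qed

lemma prob_load_gt:
  assumes S: "S \<subseteq> vecs u" and n2: "2 \<le> card S" and n: "card S \<le> 2 ^ b" and t: "0 \<le> t" "t \<le> 1"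
  shows "(\<Sum>W\<in>mats u b. of_bool (4 * ln (real (card S)) < t * real (maxload b (restrict (matvec u b W) (vecs u)) S)))
    \<le> real (card (mats u b)) * (2 * exp 1 * t\<^sup>2)"
proof -
  let ?n = "real (card S)"
  have fS: "finite S"
    using S by (rule finite_subset) simp
  \<comment> \<open>Start with every ball alone in its bin \<open>(0, x)\<close>; hashing these
    points with \<open>W\<close> is just applying \<open>W\<close>.\<close>
  define \<tau> where "\<tau> s = (\<lambda>_::nat. False, s)" for s :: "nat \<Rightarrow> bool"
  have \<tau>: "\<tau> ` S \<subseteq> vecs b \<times> vecs u"
    using S by (auto simp: \<tau>_def vecs_def)
  have hash: "hash u b W \<circ> \<tau> = matvec u b W" for W
    by (auto simp: hash_def \<tau>_def xorv_def)
  have imp: "?n < energy t S (vecs b) (hash u b W \<circ> \<tau>)"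
    if "4 * ln ?n < t * real (maxload b (restrict (matvec u b W) (vecs u)) S)" for W
  proof -
    let ?T = "restrict (matvec u b W) (vecs u)"
    have "maxload b ?T S \<in> (\<lambda>y. card {x \<in> S. ?T x = y}) ` vecs b"
      unfolding maxload_def 
      by (rule Max_in) (use matvec_in_vecs[of u b W] in auto)
    then obtain y where y: "y \<in> vecs b" "maxload b ?T S = card {x \<in> S. ?T x = y}"
      by auto
    have "{x \<in> S. ?T x = y} = {x \<in> S. matvec u b W x = y}"
      using S by auto
    with y that have "?n < excess t (card {x \<in> S. matvec u b W x = y})"
      using excess_le_imp_load_le[OF t(1) n2, of "card {x \<in> S. matvec u b W x = y}"]
      by (metis not_le)
    also have "excess t (card {x \<in> S. matvec u b W x = y}) \<le> energy t S (vecs b) (matvec u b W)"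
      unfolding energy_def
      by (rule member_le_sum[OF y(1), where f = "\<lambda>y. excess t (card {x \<in> S. matvec u b W x = y})"])
        (auto simp: excess_nonneg)
    finally show ?thesis
      by (simp add: hash)
  qed
  have "energy t S (vecs b \<times> vecs u) \<tau> \<le> t\<^sup>2 * ?n"
    by (rule energy_inj_on) (use fS t \<tau> in \<open>auto simp: \<tau>_def inj_on_def\<close>)
  \<comment> \<open>The 2 counts the initial energy and the added \<open>t^2 n\<close>, each at most
    \<open>t^2 n\<close>.\<close>
  then have E: "energy t S (vecs b \<times> vecs u) \<tau> + t\<^sup>2 * ?n \<le> ?n * (2 * t\<^sup>2)"
    by (simp add: mult.commute)
  have "?n * (\<Sum>W\<in>mats u b. of_bool (4 * ln ?n < t * real (maxload b (restrict (matvec u b W) (vecs u)) S)))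
      \<le> ?n * (\<Sum>W\<in>mats u b. of_bool (?n < energy t S (vecs b) (hash u b W \<circ> \<tau>)))"
    by (intro mult_left_mono sum_mono) (use imp in auto)
  also have "\<dots> \<le> real (card (mats u b)) * (exp (1 - 1 / 2 ^ u) *
      (energy t S (vecs b \<times> vecs u) \<tau> + t\<^sup>2 * ?n))"
    by (rule prob_energy_hash_gt[OF fS n \<tau>])
  also have "\<dots> \<le> real (card (mats u b)) * (exp 1 * (?n * (2 * t\<^sup>2)))"
    by (intro mult_left_mono mult_mono E) (auto simp: energy_nonneg)
  also have "\<dots> = ?n * (real (card (mats u b)) * (2 * exp 1 * t\<^sup>2))"
    by (simp only: mult_ac)
  finally show ?thesis
    using n2 by (subst (asm) mult_le_cancel_left_pos) auto
qed

section \<open>From the tail bound to the expectation\<close>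

lemma le_one_plus_dyadic_sum:
  fixes x :: real
  assumes "x \<le> 2 ^ m"
  shows "x \<le> 1 + (\<Sum>j<m. 2 ^ j * of_bool (2 ^ j < x))"
  using assms
proof (induction m)
  case (Suc m)
  show ?case
  proof (cases "2 ^ m < x")
    \<comment> \<open>Passing the top threshold means passing all of them, so the powers sum to
      \<open>2 ^ Suc m - 1\<close>.\<close>
    case True
    then have "2 ^ j < x" if "j < m" for j
      using that by (meson less_trans one_less_numeral_iff power_strict_increasing semiring_norm(76))
    then have "(\<Sum>j<Suc m. 2 ^ j * of_bool (2 ^ j < x)) = (\<Sum>j<Suc m. 2 ^ j :: real)"
      using True by (intro sum.cong refl) (auto simp: less_Suc_eq)
    also have "\<dots> = 2 ^ Suc m - 1"
      by (subst geometric_sum) auto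
    finally show ?thesis
      using Suc.prems by simp
  qed (use Suc in simp)
qed simp

lemma sum_maxload_le:
  assumes S: "S \<subseteq> vecs u" and n2: "2 \<le> card S" and n: "card S \<le> 2 ^ b"
  shows "(\<Sum>W\<in>mats u b. real (maxload b (restrict (matvec u b W) (vecs u)) S))
    \<le> real (card (mats u b)) * (4 * ln (real (card S)) * (1 + 4 * exp 1))"
proof -
  let ?L = "\<lambda>W. real (maxload b (restrict (matvec u b W) (vecs u)) S)"
  define r where "r = 4 * ln (real (card S))"
  have r: "0 < r"
    using n2 by (simp add: r_def)
  \<comment> \<open>A common cutoff for all matrices keeps the dyadic sum finite; the final bound is
    independent of \<open>m\<close>.\<close>
  obtain m :: nat where m: "\<And>W. W \<in> mats u b \<Longrightarrow> ?L W / r \<le> 2 ^ m"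
  proof -
    obtain m :: nat where m: "Max ((\<lambda>W. ?L W / r) ` mats u b) < 2 ^ m"
      using real_arch_pow[of 2] by force
    have "?L W / r \<le> 2 ^ m" if "W \<in> mats u b" for W
      using that m by (intro order_trans[OF Max_ge less_imp_le[OF m]]) auto
    then show ?thesis
      by (rule that)
  qed
  \<comment> \<open>Take \<open>t = (1 / 2) ^ j\<close>: the weight \<open>2 ^ j\<close> times a
    tail of order \<open>t^2\<close> leaves \<open>(1 / 2) ^ j\<close>.\<close>
  have dyadic: "2 ^ j * (\<Sum>W\<in>mats u b. of_bool (2 ^ j < ?L W / r))
      \<le> real (card (mats u b)) * (2 * exp 1) * (1 / 2) ^ j" for j :: nat
  proof -
    have "(2 ^ j < ?L W / r) = (r < (1 / 2) ^ j * ?L W)" for W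
      using r by (simp add: field_simps power_one_over)
    then have "2 ^ j * (\<Sum>W\<in>mats u b. of_bool (2 ^ j < ?L W / r)) =
        2 ^ j * (\<Sum>W\<in>mats u b. of_bool (r < (1 / 2) ^ j * ?L W))"
      by simp
    also have "\<dots> \<le> 2 ^ j * (real (card (mats u b)) * (2 * exp 1 * ((1 / 2) ^ j)\<^sup>2))"
      unfolding r_def by (intro mult_left_mono prob_load_gt assms) (auto simp: power_le_one)
    also have "\<dots> = real (card (mats u b)) * (2 * exp 1) * (1 / 2) ^ j"
      by (simp add: power2_eq_square power_one_over)
    finally show ?thesis .
  qed
  have "(\<Sum>W\<in>mats u b. ?L W / r) \<le> (\<Sum>W\<in>mats u b. 1 + (\<Sum>j<m. 2 ^ j * of_bool (2 ^ j < ?L W / r)))"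
    by (intro sum_mono le_one_plus_dyadic_sum m)
  also have "\<dots> = real (card (mats u b)) + (\<Sum>W\<in>mats u b. \<Sum>j<m. 2 ^ j * of_bool (2 ^ j < ?L W / r))"
    by (simp add: sum.distrib)
  also have "(\<Sum>W\<in>mats u b. \<Sum>j<m. 2 ^ j * of_bool (2 ^ j < ?L W / r) :: real) =
      (\<Sum>j<m. 2 ^ j * (\<Sum>W\<in>mats u b. of_bool (2 ^ j < ?L W / r)))"
    unfolding sum_distrib_left by (rule sum.swap)
  also have "\<dots> \<le> (\<Sum>j<m. real (card (mats u b)) * (2 * exp 1) * (1 / 2) ^ j)"
    by (intro sum_mono dyadic)
  also have "\<dots> = real (card (mats u b)) * (2 * exp 1) * (\<Sum>j<m. (1 / 2) ^ j)"
    by (simp only: sum_distrib_left)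
  \<comment> \<open>The geometric sum is at most 2, whence the factor
    \<open>1 + 4 * exp 1\<close>.\<close>
  also have "\<dots> \<le> real (card (mats u b)) * (2 * exp 1) * 2"
    by (intro mult_left_mono) (auto simp: geometric_sum)
  finally have "(\<Sum>W\<in>mats u b. ?L W / r) \<le> real (card (mats u b)) * (1 + 4 * exp 1)"
    by (simp add: distrib_left mult_ac del: restrict_apply)
  then have "(\<Sum>W\<in>mats u b. ?L W) \<le> real (card (mats u b)) * (1 + 4 * exp 1) * r"
    unfolding sum_divide_distrib[symmetric] using r by (simp add: pos_divide_le_eq)
  then show ?thesis
    unfolding r_def[symmetric] by (simp only: mult_ac)
qed

theorem theorem1:
  shows "\<exists>C>0. \<forall>u b :: nat. \<forall>S. S \<subseteq> vecs u \<and> 2 \<le> card S \<and> card S \<le> 2 ^ b \<longrightarrow>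
           exp_maxload u b S \<le> C * log 2 (real (card S))"
proof (intro exI conjI allI impI)
  \<comment> \<open>The factor \<open>ln 2\<close> converts the natural logarithm to base 2.\<close>
  show "0 < 4 * ln 2 * (1 + 4 * exp 1 :: real)"
    by (intro mult_pos_pos add_pos_pos) auto
next
  fix u b :: nat and S
  assume "S \<subseteq> vecs u \<and> 2 \<le> card S \<and> card S \<le> 2 ^ b"
  then have S: "S \<subseteq> vecs u" "2 \<le> card S" "card S \<le> 2 ^ b"
    by auto
  have "mats u b \<noteq> {}"
    by (auto simp: mats_def)
  then have pos: "0 < real (card (mats u b))"
    by (simp add: card_gt_0_iff)
  have "exp_maxload u b S =
      (\<Sum>W\<in>mats u b. real (maxload b (restrict (matvec u b W) (vecs u)) S)) / real (card (mats u b))"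
    by (simp add: exp_maxload_def linmaps_def card_image[OF inj_on_matvec]
        sum.reindex[OF inj_on_matvec])
  also have "\<dots> \<le> 4 * ln (real (card S)) * (1 + 4 * exp 1)"
    using sum_maxload_le[OF S] pos by (simp only: pos_divide_le_eq mult.commute)
  also have "\<dots> = 4 * ln 2 * (1 + 4 * exp 1) * log 2 (real (card S))"
    by (simp add: log_def)
  finally show "exp_maxload u b S \<le> 4 * ln 2 * (1 + 4 * exp 1) * log 2 (real (card S))" .
qed

end
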